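(* Let $\mathrm{d}$ be a nilpotent operator on a real Hilbert space $W$ with dense domain $V$, and let $f\in W$. If $(\sigma,u,p)\in V\times V\times\mathfrak{H}$ solves the Hodge–Laplace mixed variational problem $$\begin{aligned}\langle\sigma,\tau\rangle-\langle u,\mathrm{d}\tau\rangle&=0,&&\forall\tau\in V,\\ \langle\mathrm{d}\sigma,v\rangle+\langle\mathrm{d}u,\mathrm{d}v\rangle+\langle p,v\rangle&=\langle f,v\rangle,&&\forall v\in V,\\ \langle u,q\rangle&=0,&&\forall q\in\mathfrak{H},\end{aligned}$$ then $(w,p)=(\sigma+\mathrm{d}u,\,p)\in V\times\mathfrak{H}$ solves the Hodge–Dirac variational problem $$\langle\mathrm{d}w,v\rangle+\langle w,\mathrm{d}v\rangle+\langle p,v\rangle=\langle f,v\rangle\quad\forall v\in V,\qquad\langle w,q\rangle=0\quad\forall q\in\mathfrak{H}.$$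
   Context: $W$ has inner product $\langle\cdot,\cdot\rangle$. A closed, densely defined linear operator $\mathrm{d}$ on $W$ with domain $V=\mathcal{D}(\mathrm{d})$ is nilpotent if its range is contained in its kernel (so $\mathrm{d}^2=0$). Set $\mathfrak{Z}=\ker\mathrm{d}$, $\mathfrak{B}=\operatorname{range}\mathrm{d}$, $\mathfrak{H}=\mathfrak{Z}\cap\mathfrak{B}^{\perp_W}$, where $\perp_W$ is the orthogonal complement in $W$. *)

theory Defs
  imports "HOL-Analysis.Analysis"
begin

(* An unbounded operator on W is a pair (V, d) of its domain V and a function d on the type W;
   the values of d outside V are irrelevant, and no definition below refers to them. *)

definition op_graph :: "'a set \<Rightarrow> ('a \<Rightarrow> 'a) \<Rightarrow> ('a \<times> 'a) set" where
  "op_graph V d = {(x, d x) | x. x \<in> V}"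

definition op_kernel :: "'a::zero set \<Rightarrow> ('a \<Rightarrow> 'a) \<Rightarrow> 'a set" where
  "op_kernel V d = {x \<in> V. d x = 0}"

definition op_range :: "'a set \<Rightarrow> ('a \<Rightarrow> 'a) \<Rightarrow> 'a set" where
  "op_range V d = d ` V"

definition linear_operator :: "'a::real_vector set \<Rightarrow> ('a \<Rightarrow> 'a) \<Rightarrow> bool" where
  "linear_operator V d \<longleftrightarrow> subspace V \<and>
     (\<forall>x\<in>V. \<forall>y\<in>V. d (x + y) = d x + d y) \<and>
     (\<forall>c. \<forall>x\<in>V. d (c *\<^sub>R x) = c *\<^sub>R d x)"

(* The inclusion of the range in the kernel contains the requirement that d maps V into V. *)
definition nilpotent_operator :: "'a::real_inner set \<Rightarrow> ('a \<Rightarrow> 'a) \<Rightarrow> bool" where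
  "nilpotent_operator V d \<longleftrightarrow>
     linear_operator V d \<and> closure V = UNIV \<and> closed (op_graph V d) \<and>
     op_range V d \<subseteq> op_kernel V d"

definition harmonic_space :: "'a::real_inner set \<Rightarrow> ('a \<Rightarrow> 'a) \<Rightarrow> 'a set" where
  "harmonic_space V d = op_kernel V d \<inter> (op_range V d)\<^sup>\<bottom>"

definition solves_hodge_laplace ::
  "'a::real_inner set \<Rightarrow> ('a \<Rightarrow> 'a) \<Rightarrow> 'a \<Rightarrow> 'a \<times> 'a \<times> 'a \<Rightarrow> bool" where
  "solves_hodge_laplace V d f = (\<lambda>(\<sigma>, u, p).
     \<sigma> \<in> V \<and> u \<in> V \<and> p \<in> harmonic_space V d \<and>
     (\<forall>\<tau>\<in>V. \<sigma> \<bullet> \<tau> - u \<bullet> d \<tau> = 0) \<and>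
     (\<forall>v\<in>V. d \<sigma> \<bullet> v + d u \<bullet> d v + p \<bullet> v = f \<bullet> v) \<and>
     (\<forall>q\<in>harmonic_space V d. u \<bullet> q = 0))"

definition solves_hodge_dirac ::
  "'a::real_inner set \<Rightarrow> ('a \<Rightarrow> 'a) \<Rightarrow> 'a \<Rightarrow> 'a \<times> 'a \<Rightarrow> bool" where
  "solves_hodge_dirac V d f = (\<lambda>(w, p).
     w \<in> V \<and> p \<in> harmonic_space V d \<and>
     (\<forall>v\<in>V. d w \<bullet> v + w \<bullet> d v + p \<bullet> v = f \<bullet> v) \<and>
     (\<forall>q\<in>harmonic_space V d. w \<bullet> q = 0))"

end

theory Submission
  imports Defs
begin

text \<open>The first equation says weakly that \<sigma> is the adjoint of \<open>d\<close> applied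
  to \<open>u\<close>, so \<sigma> is orthogonal to the kernel of \<open>d\<close>. Nilpotency
  places the range in that kernel. Hence, for \<open>w = \<sigma> + d u\<close>, the unwanted terms
  \<open>d (d u)\<close> and \<open>\<sigma> \<bullet> d v\<close> both vanish, and the Dirac
  equation collapses to the second Hodge-Laplace equation. Harmonic elements lie in the kernel and
  are orthogonal to the range, so they are orthogonal to both summands of \<open>w\<close>.\<close>

theorem theorem4p3:
  fixes V :: "'a::{real_inner, complete_space} set"
    and d :: "'a \<Rightarrow> 'a"
    and f \<sigma> u p :: 'a
  assumes "nilpotent_operator V d"
    and "solves_hodge_laplace V d f (\<sigma>, u, p)"
  shows "solves_hodge_dirac V d f (\<sigma> + d u, p)"
proof -
  have subV: "subspace V" and add: "\<And>x y. x \<in> V \<Longrightarrow> y \<in> V \<Longrightarrow> d (x + y) = d x + d y"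
    and dV: "\<And>x. x \<in> V \<Longrightarrow> d x \<in> V" and dd: "\<And>x. x \<in> V \<Longrightarrow> d (d x) = 0"
    using assms(1)
    by (auto simp: nilpotent_operator_def linear_operator_def op_range_def op_kernel_def)
  have V: "\<sigma> \<in> V" "u \<in> V" and p: "p \<in> harmonic_space V d"
    and eq1: "\<And>\<tau>. \<tau> \<in> V \<Longrightarrow> \<sigma> \<bullet> \<tau> = u \<bullet> d \<tau>"
    and eq2: "\<And>v. v \<in> V \<Longrightarrow> d \<sigma> \<bullet> v + d u \<bullet> d v + p \<bullet> v = f \<bullet> v"
    using assms(2) by (auto simp: solves_hodge_laplace_def)
  \<comment> \<open>Taking \<open>z\<close> as the test element in \<open>eq1\<close> makes the
    right-hand side \<open>u \<bullet> 0\<close>.\<close>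
  have \<sigma>_ker: "\<sigma> \<bullet> z = 0" if "z \<in> op_kernel V d" for z
    using that eq1 by (simp add: op_kernel_def)
  have "\<sigma> + d u \<in> V"
    using V dV subV by (simp add: subspace_add)
  moreover have "d (\<sigma> + d u) \<bullet> v + (\<sigma> + d u) \<bullet> d v + p \<bullet> v = f \<bullet> v" if "v \<in> V" for v
  proof -
    \<comment> \<open>Nilpotency makes \<open>d v\<close> an element of the kernel.\<close>
    have "\<sigma> \<bullet> d v = 0"
      using that \<sigma>_ker dV dd by (simp add: op_kernel_def)
    then show ?thesis
      using that V dV dd add eq2 by (simp add: inner_add_left)
  qed
  moreover have "(\<sigma> + d u) \<bullet> q = 0" if "q \<in> harmonic_space V d" for q
  proof -
    \<comment> \<open>This uses that \<open>q\<close> is orthogonal to the range; the companion fact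
      for \<sigma> uses that \<open>q\<close> is in the kernel.\<close>
    have "d u \<bullet> q = 0"
      using that V
      by (auto simp: harmonic_space_def orthogonal_comp_def orthogonal_def op_range_def)
    moreover have "\<sigma> \<bullet> q = 0"
      using that \<sigma>_ker by (simp add: harmonic_space_def)
    ultimately show ?thesis
      by (simp add: inner_add_left)
  qed
  ultimately show ?thesis
    using p by (simp add: solves_hodge_dirac_def)
qed

end
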